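(* Let $G$ be a finite simple connected graph on the vertex set $\{1,\dots,\ell\}$ and let $\kappa=\kappa(G)$ be its connectivity. Then there exists a minimal generating set of the $S$-module $D(\mathcal{A}(G))$ which consists of the derivations $\theta_0,\theta_1,\dots,\theta_\kappa$ together with a finite set of separator-based $\mathcal{A}$-derivations $\theta_C^T$, where $T$ is a separator of $G$ and $C$ is a connected component of $G\setminus T$.
   Context: Let $\mathbb{K}$ be a field and $S=\mathbb{K}[x_1,\dots,x_\ell]$. For a finite simple undirected graph $G=(V,E)$ with $V=\{1,\dots,\ell\}$, the graphic arrangement is $\mathcal{A}(G)=\{\ker(x_i-x_j) : \{i,j\}\in E\}$ in $\mathbb{K}^\ell$. $\mathrm{Der}_{\mathbb{K}}(S)$ denotes the free $S$-module of $\mathbb{K}$-linear derivations of $S$, with basis $D_i=\partial/\partial x_i$, and $D(\mathcal{A}(G))=\{\theta\in \mathrm{Der}_{\mathbb{K}}(S) : \theta(x_i-x_j)\in (x_i-x_j)S \text{ for all } \{i,j\}\in E\}$. For $k\ge 0$, $\theta_k=\sum_{i=1}^\ell x_i^k D_i$. A graph is $k$-connected if it has more than $k$ vertices and remains connected after deleting any set of fewer than $k$ vertices; the connectivity $\kappa(G)$ is the largest $k$ such that $G$ is $k$-connected. A set $T\subseteq V$ is a separator of $G$ if there are vertices $a,b\notin T$ such that every path from $a$ to $b$ in $G$ contains a vertex of $T$. For a separator $T$ and (the vertex set of) a connected component $C$ of $G\setminus T$ (the graph obtained by deleting $T$ and all incident edges), the separator-based derivation is $\theta_C^T=\sum_{i\in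 C}\prod_{t\in T}(x_i-x_t)\,D_i$. *)

theory Defs
  imports
    Complex_Main
    "HOL-Library.Poly_Mapping"
    "HOL-Library.Function_Algebras"
begin

section \<open>The polynomial ring and its derivations\<close>

text \<open>
  Polynomials over \<open>'k\<close> in the variables indexed by \<open>'v\<close>: finitely supported maps from
  exponent vectors to coefficients, with the convolution product of \<^theory>\<open>HOL-Library.Poly_Mapping\<close>.
\<close>

type_synonym ('v, 'k) mpoly = "('v \<Rightarrow>\<^sub>0 nat) \<Rightarrow>\<^sub>0 'k"

definition Const :: "'k::comm_ring_1 \<Rightarrow> ('v, 'k) mpoly" where
  "Const c = Poly_Mapping.single 0 c"

definition Var :: "'v \<Rightarrow> ('v, 'k::comm_ring_1) mpoly" where
  "Var i = Poly_Mapping.single (Poly_Mapping.single i 1) 1"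

definition Der :: "(('v, 'k::field) mpoly \<Rightarrow> ('v, 'k) mpoly) set" where
  "Der = {\<theta>. (\<forall>p q. \<theta> (p + q) = \<theta> p + \<theta> q) \<and>
              (\<forall>c p. \<theta> (Const c * p) = Const c * \<theta> p) \<and>
              (\<forall>p q. \<theta> (p * q) = p * \<theta> q + q * \<theta> p)}"

text \<open>
  The truncated subtraction in the exponent is harmless: it is only cut off when the exponent of
  \<open>i\<close> in \<open>m\<close> is \<open>0\<close>, and then the coefficient vanishes.
\<close>

definition partial :: "'v \<Rightarrow> ('v, 'k::comm_ring_1) mpoly \<Rightarrow> ('v, 'k) mpoly" where
  "partial i p = (\<Sum>m\<in>Poly_Mapping.keys p.
     Poly_Mapping.single (m - Poly_Mapping.single i 1)
       (of_nat (Poly_Mapping.lookup m i) * Poly_Mapping.lookup p m))"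

text \<open>
  The module structure over the polynomial ring on its self-maps; addition is the pointwise one
  of \<^theory>\<open>HOL-Library.Function_Algebras\<close>. \<^const>\<open>Der\<close> and \<open>D_graphic\<close> below are submodules.
\<close>

definition der_scale ::
  "('v, 'k::field) mpoly \<Rightarrow> (('v, 'k) mpoly \<Rightarrow> ('v, 'k) mpoly) \<Rightarrow> ('v, 'k) mpoly \<Rightarrow> ('v, 'k) mpoly" where
  "der_scale f \<theta> = (\<lambda>p. f * \<theta> p)"

global_interpretation der: module der_scale
  defines der_span = der.span
  by unfold_locales (auto simp: der_scale_def fun_eq_iff algebra_simps)

definition minimal_generating_set ::
  "(('v, 'k::field) mpoly \<Rightarrow> ('v, 'k) mpoly) set \<Rightarrow> (('v, 'k) mpoly \<Rightarrow> ('v, 'k) mpoly) set \<Rightarrow> bool" where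
  "minimal_generating_set M B \<longleftrightarrow> der_span B = M \<and> (\<forall>B'. B' \<subset> B \<longrightarrow> der_span B' \<noteq> M)"


section \<open>Finite simple graphs\<close>

definition simple_graph :: "'v set \<Rightarrow> 'v set set \<Rightarrow> bool" where
  "simple_graph V E \<longleftrightarrow> finite V \<and> (\<forall>e\<in>E. e \<subseteq> V \<and> card e = 2)"

definition is_path :: "'v set \<Rightarrow> 'v set set \<Rightarrow> 'v \<Rightarrow> 'v list \<Rightarrow> 'v \<Rightarrow> bool" where
  "is_path V E a p b \<longleftrightarrow> p \<noteq> [] \<and> hd p = a \<and> last p = b \<and> set p \<subseteq> V \<and> distinct p \<and>
     successively (\<lambda>u v. {u, v} \<in> E) p"

definition connected_graph :: "'v set \<Rightarrow> 'v set set \<Rightarrow> bool" where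
  "connected_graph V E \<longleftrightarrow> V \<noteq> {} \<and> (\<forall>a\<in>V. \<forall>b\<in>V. \<exists>p. is_path V E a p b)"

text \<open>For a set \<open>T\<close> of vertices, \<open>(V - T, E \<setminus>\<^sub>E T)\<close> is the graph obtained from \<open>(V, E)\<close> by deleting \<open>T\<close>.\<close>

definition del_edges :: "'v set set \<Rightarrow> 'v set \<Rightarrow> 'v set set" (infixl \<open>\<setminus>\<^sub>E\<close> 65) where
  "E \<setminus>\<^sub>E T = {e \<in> E. e \<inter> T = {}}"

text \<open>The vertex sets of the connected components.\<close>

definition components :: "'v set \<Rightarrow> 'v set set \<Rightarrow> 'v set set" where
  "components V E = {{b \<in> V. \<exists>p. is_path V E a p b} | a. a \<in> V}"

definition k_connected :: "'v set \<Rightarrow> 'v set set \<Rightarrow> nat \<Rightarrow> bool" where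
  "k_connected V E k \<longleftrightarrow> card V > k \<and>
     (\<forall>X \<subseteq> V. card X < k \<longrightarrow> connected_graph (V - X) (E \<setminus>\<^sub>E X))"

definition connectivity :: "'v set \<Rightarrow> 'v set set \<Rightarrow> nat" where
  "connectivity V E = (GREATEST k. k_connected V E k)"

definition separator :: "'v set \<Rightarrow> 'v set set \<Rightarrow> 'v set \<Rightarrow> bool" where
  "separator V E T \<longleftrightarrow> T \<subseteq> V \<and>
     (\<exists>a\<in>V - T. \<exists>b\<in>V - T. \<forall>p. is_path V E a p b \<longrightarrow> set p \<inter> T \<noteq> {})"


section \<open>Derivations of graphic arrangements\<close>

text \<open>
  From here on the vertex set is the finite index type \<open>'v\<close> of the variables, so that \<open>CARD('v)\<close>
  is the dimension \<open>\<ell>\<close> of the ambient space. Membership in the principal ideal generated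
  by \<open>x\<^sub>i - x\<^sub>j\<close> is divisibility by \<open>x\<^sub>i - x\<^sub>j\<close>.
\<close>

definition D_graphic :: "'v::finite set set \<Rightarrow> (('v, 'k::field) mpoly \<Rightarrow> ('v, 'k) mpoly) set" where
  "D_graphic E = {\<theta> \<in> Der. \<forall>i j. {i, j} \<in> E \<longrightarrow> (Var i - Var j) dvd \<theta> (Var i - Var j)}"

definition theta :: "nat \<Rightarrow> ('v::finite, 'k::field) mpoly \<Rightarrow> ('v, 'k) mpoly" where
  "theta k = (\<Sum>i\<in>UNIV. der_scale (Var i ^ k) (partial i))"

definition theta_sep :: "'v::finite set \<Rightarrow> 'v set \<Rightarrow> ('v, 'k::field) mpoly \<Rightarrow> ('v, 'k) mpoly" where
  "theta_sep T C = (\<Sum>i\<in>C. der_scale (\<Prod>t\<in>T. Var i - Var t) (partial i))"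

end

theory Submission
  imports Defs "HOL-Computational_Algebra.Polynomial"
begin

text \<open>
  Generation goes by induction on the number of missing edges. For the complete graph, Newton
  interpolation shows that every derivation in \<open>D\<close> sends \<open>x\<^sub>i\<close> to \<open>P(x\<^sub>i)\<close> for a single polynomial
  \<open>P\<close> of degree less than \<open>\<ell>\<close>. If \<open>ab\<close> is a missing edge and \<open>\<theta> \<in> D(A(G))\<close>, then every path from
  \<open>a\<close> to \<open>b\<close> puts \<open>\<theta>(x\<^sub>a - x\<^sub>b)\<close>, modulo \<open>x\<^sub>a - x\<^sub>b\<close>, into the ideal generated by the \<open>x\<^sub>a - x\<^sub>t\<close> for
  the inner vertices \<open>t\<close> of the path. The intersection of these monomial primes is generated by the
  products of \<open>x\<^sub>a - x\<^sub>t\<close> over \<open>t \<in> T\<close>, where \<open>T\<close> separates \<open>a\<close> from \<open>b\<close>; these products are attained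
  by separator-based derivations, so subtracting multiples of them moves \<open>\<theta>\<close> into
  \<open>D(A(G + ab))\<close>. The derivations \<open>\<theta>\<^sub>k\<close> with \<open>\<kappa> < k \<le> \<ell> - 2\<close> are eliminated because a separator of
  size \<open>k\<close> gives a monic polynomial of degree \<open>k\<close> whose derivation is a sum of separator-based ones;
  for \<open>k = \<ell> - 1\<close> the same works with \<open>x\<^sub>a - x\<^sub>b\<close> times the derivation of \<open>T = V - {a, b}\<close>, \<open>C = {a}\<close>.

  For minimality, take the set of separator-based derivations as small as possible. The
  degree \<open>k\<close> part of a relation expressing \<open>\<theta>\<^sub>k\<close> by the other generators either has a nonzero constant
  in front of a separator-based derivation, which is then superfluous, or it writes \<open>\<theta>\<^sub>k\<close> in
  terms of \<open>\<theta>\<^sub>0, \<dots>, \<theta>\<^sub>k\<^sub>-\<^sub>1\<close>, which gives a monic polynomial of degree \<open>k\<close> with the \<open>\<ell> > k\<close> roots \<open>x\<^sub>i\<close>.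
\<close>

section \<open>Polynomials\<close>

lemma mpoly_eq_sum_monomials:
  fixes p :: "'a \<Rightarrow>\<^sub>0 'b::comm_monoid_add"
  shows "p = (\<Sum>m\<in>Poly_Mapping.keys p. Poly_Mapping.single m (Poly_Mapping.lookup p m))"
  by (rule poly_mapping_eqI)
    (auto simp: lookup_sum lookup_single when_def in_keys_iff)

lemma mpoly_monomial_induct [case_names monomial add]:
  fixes p :: "'a \<Rightarrow>\<^sub>0 'b::comm_monoid_add"
  assumes monomial: "\<And>m c. P (Poly_Mapping.single m c)"
    and add: "\<And>p q. P p \<Longrightarrow> P q \<Longrightarrow> P (p + q)"
  shows "P p"
proof -
  have "P (\<Sum>m\<in>A. Poly_Mapping.single m (Poly_Mapping.lookup p m))" if "finite A" for A
    using that
  proof (induction A rule: finite_induct)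
    case empty
    show ?case using monomial[of undefined 0] by simp
  next
    case (insert m A)
    then show ?case by (simp add: monomial add)
  qed
  then have "P (\<Sum>m\<in>Poly_Mapping.keys p. Poly_Mapping.single m (Poly_Mapping.lookup p m))" by simp
  then show ?thesis by (simp only: mpoly_eq_sum_monomials[of p, symmetric])
qed

lemma Var_power: "(Var i :: ('v, 'k::comm_ring_1) mpoly) ^ n = Poly_Mapping.single (Poly_Mapping.single i n) 1"
  by (induction n) (simp_all add: Var_def mult_single single_add[symmetric])

lemma prod_single:
  "finite A \<Longrightarrow> (\<Prod>i\<in>A. Poly_Mapping.single (g i) (1::'k::comm_ring_1)) = Poly_Mapping.single (\<Sum>i\<in>A. g i) 1"
  by (induction A rule: finite_induct) (simp_all add: mult_single)

lemma sum_single_lookup: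
  "(\<Sum>i\<in>UNIV. Poly_Mapping.single i (Poly_Mapping.lookup m i)) = (m :: 'v::finite \<Rightarrow>\<^sub>0 nat)"
  by (rule poly_mapping_eqI) (simp add: lookup_sum lookup_single when_def)

lemma single_eq_Const_mult_prod_Var:
  "Poly_Mapping.single m c = Const c * (\<Prod>i\<in>UNIV. (Var i :: ('v::finite, 'k::comm_ring_1) mpoly) ^ Poly_Mapping.lookup m i)"
  by (simp add: Var_power prod_single sum_single_lookup Const_def mult_single)

text \<open>A monomial is a constant times a product of powers of variables, so identities between
  ring homomorphisms or derivations need checking on these generators only.\<close>

lemma mpoly_induct [case_names Const Var add mult]:
  fixes p :: "('v::finite, 'k::comm_ring_1) mpoly"
  assumes Const: "\<And>c. P (Const c)"
    and Var: "\<And>i. P (Var i)"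
    and add: "\<And>p q. P p \<Longrightarrow> P q \<Longrightarrow> P (p + q)"
    and mult: "\<And>p q. P p \<Longrightarrow> P q \<Longrightarrow> P (p * q)"
  shows "P p"
proof (induction p rule: mpoly_monomial_induct)
  case (monomial m c)
  have one: "P 1" using Const[of 1] by (simp add: Const_def)
  have pow: "P (Var i ^ n)" for i n
    by (induction n) (simp_all add: one Var mult)
  have "P (\<Prod>i\<in>A. Var i ^ Poly_Mapping.lookup m i)" if "finite A" for A
    using that by (induction A rule: finite_induct) (simp_all add: one pow mult)
  then show ?case
    unfolding single_eq_Const_mult_prod_Var by (intro mult Const) simp
qed (rule add)

section \<open>Substitution endomorphisms of the polynomial ring\<close>

definition mpoly_subst :: "('v \<Rightarrow> ('v::finite, 'k::comm_ring_1) mpoly) \<Rightarrow> ('v, 'k) mpoly \<Rightarrow> ('v, 'k) mpoly" where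
  "mpoly_subst \<sigma> p = (\<Sum>m\<in>Poly_Mapping.keys p.
     Const (Poly_Mapping.lookup p m) * (\<Prod>i\<in>UNIV. \<sigma> i ^ Poly_Mapping.lookup m i))"

lemma mpoly_subst_single:
  "mpoly_subst \<sigma> (Poly_Mapping.single m c) = Const c * (\<Prod>i\<in>UNIV. \<sigma> i ^ Poly_Mapping.lookup m i)"
  by (auto simp: mpoly_subst_def Const_def)

lemma mpoly_subst_add [simp]: "mpoly_subst \<sigma> (p + q) = mpoly_subst \<sigma> p + mpoly_subst \<sigma> q"
  unfolding mpoly_subst_def
  by (rule setsum_keys_plus_distrib) (simp_all add: Const_def single_add algebra_simps)

lemma mpoly_subst_mult [simp]: "mpoly_subst \<sigma> (p * q) = mpoly_subst \<sigma> p * mpoly_subst \<sigma> q"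
proof (induction p rule: mpoly_monomial_induct)
  case (monomial m c)
  show ?case
  proof (induction q rule: mpoly_monomial_induct)
    case (monomial n d)
    have "Const (c * d) = Const c * (Const d :: ('a, 'b) mpoly)"
      by (simp add: Const_def mult_single)
    then show ?case
      by (simp add: mult_single mpoly_subst_single lookup_add power_add prod.distrib algebra_simps)
  qed (simp add: distrib_left)
qed (simp add: distrib_right)

lemma mpoly_subst_Const [simp]: "mpoly_subst \<sigma> (Const c) = Const c"
  by (simp add: Const_def[of c] mpoly_subst_single)

lemma mpoly_subst_Var [simp]: "mpoly_subst \<sigma> (Var i) = \<sigma> i"
proof -
  have "(\<Prod>j\<in>UNIV. \<sigma> j ^ Poly_Mapping.lookup (Poly_Mapping.single i (1::nat)) j)
      = (\<Prod>j\<in>UNIV. if i = j then \<sigma> j else 1)"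
    by (rule prod.cong) (auto simp: lookup_single when_def)
  then show ?thesis
    unfolding Var_def mpoly_subst_single by (simp add: Const_def)
qed

lemma mpoly_subst_0 [simp]: "mpoly_subst \<sigma> 0 = 0"
  by (simp add: mpoly_subst_def)

lemma mpoly_subst_1 [simp]: "mpoly_subst \<sigma> 1 = 1"
  using mpoly_subst_Const[of \<sigma> 1] by (simp add: Const_def)

lemma mpoly_subst_diff [simp]: "mpoly_subst \<sigma> (p - q) = mpoly_subst \<sigma> p - mpoly_subst \<sigma> q"
  using mpoly_subst_add[of \<sigma> "p - q" q] by (simp add: algebra_simps)

lemma mpoly_subst_prod [simp]: "mpoly_subst \<sigma> (\<Prod>i\<in>A. f i) = (\<Prod>i\<in>A. mpoly_subst \<sigma> (f i))"
  by (induction A rule: infinite_finite_induct) simp_all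

lemma mpoly_subst_sum [simp]: "mpoly_subst \<sigma> (\<Sum>i\<in>A. f i) = (\<Sum>i\<in>A. mpoly_subst \<sigma> (f i))"
  by (induction A rule: infinite_finite_induct) simp_all

lemma mpoly_subst_comp:
  "mpoly_subst \<sigma> (mpoly_subst \<tau> p) = mpoly_subst (\<lambda>i. mpoly_subst \<sigma> (\<tau> i)) p"
  by (induction p rule: mpoly_induct) simp_all

lemma mpoly_subst_Var_id [simp]: "mpoly_subst Var p = p"
  by (induction p rule: mpoly_induct) simp_all

section \<open>Congruences and restriction to a hyperplane\<close>

lemma dvd_mult_diff_mult:
  fixes d :: "'a::comm_ring_1"
  assumes "d dvd a - a'" "d dvd b - b'"
  shows "d dvd a * b - a' * b'"
proof -
  have "a * b - a' * b' = (a - a') * b + a' * (b - b')" by (simp add: algebra_simps)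
  then show ?thesis using assms by simp
qed

text \<open>Modulo \<open>d\<close> both substitutions are ring homomorphisms that agree on the
  generators.\<close>

lemma dvd_mpoly_subst_diff:
  assumes "\<And>i. d dvd \<sigma> i - \<tau> i"
  shows "d dvd mpoly_subst \<sigma> p - mpoly_subst \<tau> p"
proof (induction p rule: mpoly_induct)
  case (add p q)
  then show ?case using dvd_add[OF add] by (simp add: algebra_simps)
qed (auto intro: dvd_mult_diff_mult assms)

text \<open>Restriction to the hyperplane where \<open>Var a\<close> and \<open>Var b\<close>
  coincide, realised as an endomorphism instead of a map to a quotient ring.\<close>

definition merge :: "'v \<Rightarrow> 'v \<Rightarrow> ('v::finite, 'k::comm_ring_1) mpoly \<Rightarrow> ('v, 'k) mpoly" where
  "merge a b = mpoly_subst (Var(b := Var a))"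

lemma dvd_diff_merge:
  fixes p :: "('v::finite, 'k::comm_ring_1) mpoly"
  shows "Var a - Var b dvd p - merge a b p"
proof -
  have "Var a - Var b dvd mpoly_subst Var p - mpoly_subst (Var(b := Var a)) p"
  proof (rule dvd_mpoly_subst_diff)
    show "(Var a - Var b :: ('v, 'k) mpoly) dvd Var i - (Var(b := Var a)) i" for i
      using dvd_minus_iff[of "Var a - Var b :: ('v, 'k) mpoly" "Var a - Var b"] by simp
  qed
  then show ?thesis by (simp add: merge_def)
qed

text \<open>The kernel of the restriction is the principal ideal of the hyperplane; divisibility
  becomes an equation.\<close>

lemma dvd_iff_merge_eq_0: "Var a - Var b dvd p \<longleftrightarrow> merge a b p = 0"
proof
  assume "Var a - Var b dvd p"
  then obtain q where "p = (Var a - Var b) * q" ..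
  then show "merge a b p = 0" by (simp add: merge_def)
next
  assume "merge a b p = 0"
  then show "Var a - Var b dvd p" using dvd_diff_merge[of a b p] by simp
qed

text \<open>Stands in for an integral domain structure: only differences of variables and their
  products ever have to be cancelled.\<close>

definition nzdiv :: "'a::comm_ring_1 \<Rightarrow> bool" where
  "nzdiv d \<longleftrightarrow> (\<forall>q. d * q = 0 \<longrightarrow> q = 0)"

lemma nzdivD: "nzdiv d \<Longrightarrow> d * q = 0 \<Longrightarrow> q = 0"
  by (simp add: nzdiv_def)

lemma nzdiv_mult: "nzdiv c \<Longrightarrow> nzdiv d \<Longrightarrow> nzdiv (c * d)"
  unfolding nzdiv_def by (metis mult.assoc)

lemma nzdiv_prod: "(\<And>i. i \<in> A \<Longrightarrow> nzdiv (f i)) \<Longrightarrow> nzdiv (\<Prod>i\<in>A. f i)"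
  by (induction A rule: infinite_finite_induct) (simp_all add: nzdiv_mult, simp_all add: nzdiv_def)

text \<open>Multiplication by \<open>Var i\<close> translates exponent vectors, and translation is
  injective, so every coefficient of \<open>q\<close> can be read off the product.\<close>

lemma nzdiv_Var: "nzdiv (Var i :: ('v, 'k::comm_ring_1) mpoly)"
  unfolding nzdiv_def
proof (intro allI impI)
  fix q :: "('v, 'k) mpoly"
  assume 0: "Var i * q = 0"
  have "Poly_Mapping.lookup q k = 0" for k
  proof -
    have "Var i * q = (\<Sum>m\<in>Poly_Mapping.keys q. Poly_Mapping.single (Poly_Mapping.single i 1 + m) (Poly_Mapping.lookup q m))"
      by (subst mpoly_eq_sum_monomials[of q]) (simp add: Var_def sum_distrib_left mult_single)
    then have "Poly_Mapping.lookup (Var i * q) (Poly_Mapping.single i 1 + k) = Poly_Mapping.lookup q k"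
      by (simp add: lookup_sum lookup_single when_def in_keys_iff)
    then show ?thesis by (simp add: 0)
  qed
  then show "q = 0" by (simp add: poly_mapping_eqI)
qed

text \<open>The invertible change of coordinates \<open>Var a\<close> to
  \<open>Var a + Var b\<close> turns the difference into a variable.\<close>

lemma nzdiv_Var_diff:
  assumes "a \<noteq> b"
  shows "nzdiv (Var a - Var b :: ('v::finite, 'k::comm_ring_1) mpoly)"
  unfolding nzdiv_def
proof (intro allI impI)
  fix q :: "('v, 'k) mpoly"
  assume "(Var a - Var b) * q = 0"
  then have "mpoly_subst (Var(a := Var a + Var b)) ((Var a - Var b) * q) = 0" by simp
  then have "Var a * mpoly_subst (Var(a := Var a + Var b)) q = 0"
    using assms by simp
  then have "mpoly_subst (Var(a := Var a + Var b)) q = 0"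
    by (rule nzdivD[OF nzdiv_Var])
  then have "mpoly_subst (Var(a := Var a - Var b)) (mpoly_subst (Var(a := Var a + Var b)) q) = 0"
    by simp
  moreover have "(\<lambda>i. mpoly_subst (Var(a := Var a - Var b)) ((Var(a := Var a + Var b)) i)) = (Var :: 'v \<Rightarrow> ('v, 'k) mpoly)"
    using assms by auto
  ultimately show "q = 0" by (simp add: mpoly_subst_comp)
qed

text \<open>Factors are split off one at a time: \<open>merge a c\<close> fixes the factors already
  removed, and these can be cancelled, so it kills the remaining quotient.\<close>

lemma prod_Var_diff_dvd:
  fixes p :: "('v::finite, 'k::comm_ring_1) mpoly"
  assumes "a \<notin> W" "\<And>b. b \<in> W \<Longrightarrow> Var a - Var b dvd p"
  shows "(\<Prod>b\<in>W. Var a - Var b) dvd p"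
  using finite[of W] assms
proof (induction W rule: finite_induct)
  case (insert c W)
  then obtain q where q: "p = (\<Prod>b\<in>W. Var a - Var b) * q" by (auto elim: dvdE)
  have "merge a c p = 0" using insert.prems by (simp add: dvd_iff_merge_eq_0[symmetric])
  moreover have "(\<Prod>b\<in>W. merge a c (Var a - Var b)) = (\<Prod>b\<in>W. Var a - Var b :: ('v, 'k) mpoly)"
    using insert.hyps insert.prems by (intro prod.cong) (auto simp: merge_def)
  ultimately have "(\<Prod>b\<in>W. Var a - Var b) * merge a c q = 0"
    by (simp add: q merge_def del: mpoly_subst_diff)
  moreover have "nzdiv (\<Prod>b\<in>W. Var a - Var b :: ('v, 'k) mpoly)"
    using insert.prems by (intro nzdiv_prod nzdiv_Var_diff) auto
  ultimately have "merge a c q = 0" by (simp add: nzdiv_def)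
  then have "Var a - Var c dvd q" by (simp add: dvd_iff_merge_eq_0)
  then show ?case using insert.hyps by (simp add: q mult.commute mult_dvd_mono)
qed simp

section \<open>Derivations\<close>

lemma partial_single:
  "partial i (Poly_Mapping.single m c)
   = Poly_Mapping.single (m - Poly_Mapping.single i 1) (of_nat (Poly_Mapping.lookup m i) * c)"
  by (auto simp: partial_def)

lemma partial_add: "partial i (p + q) = partial i p + partial i q"
  unfolding partial_def
  by (rule setsum_keys_plus_distrib) (simp_all add: single_add algebra_simps)

lemma partial_mult:
  fixes p q :: "('v, 'k::comm_ring_1) mpoly"
  shows "partial i (p * q) = p * partial i q + q * partial i p"
proof (induction p rule: mpoly_monomial_induct)
  case (monomial m c)
  show ?case
  proof (induction q rule: mpoly_monomial_induct)
    case (monomial n d)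
    let ?e = "Poly_Mapping.single i (1::nat)"
    \<comment> \<open>The truncated subtraction commutes with adding exponents only where the
      exponent of \<open>i\<close> is positive; otherwise the coefficient is zero.\<close>
    have 1: "m + (n - ?e) = (m + n) - ?e" if "Poly_Mapping.lookup n i \<noteq> 0"
      using that by (intro poly_mapping_eqI) (auto simp: lookup_add lookup_minus lookup_single when_def)
    have 2: "n + (m - ?e) = (m + n) - ?e" if "Poly_Mapping.lookup m i \<noteq> 0"
      using that by (intro poly_mapping_eqI) (auto simp: lookup_add lookup_minus lookup_single when_def)
    show ?case
      using 1 2
      by (cases "Poly_Mapping.lookup m i = 0"; cases "Poly_Mapping.lookup n i = 0")
        (simp_all add: partial_single mult_single lookup_add single_add[symmetric] algebra_simps)
  qed (simp add: distrib_left distrib_right partial_add algebra_simps)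
qed (simp add: distrib_left distrib_right partial_add algebra_simps)

lemma partial_Const [simp]: "partial i (Const c) = 0"
  by (simp add: Const_def partial_single)

lemma partial_Var: "partial i (Var j) = (if i = j then 1 else 0)"
  by (auto simp: Var_def partial_single lookup_single)

lemma DerD:
  assumes "\<theta> \<in> Der"
  shows "\<theta> (p + q) = \<theta> p + \<theta> q" "\<theta> (Const c * p) = Const c * \<theta> p" "\<theta> (p * q) = p * \<theta> q + q * \<theta> p"
  using assms by (auto simp: Der_def)

lemma Der_diff: "\<theta> \<in> Der \<Longrightarrow> \<theta> (p - q) = \<theta> p - \<theta> q"
  using DerD(1)[of \<theta> "p - q" q] by (simp add: algebra_simps)

lemma Der_Const:
  assumes "\<theta> \<in> Der"
  shows "\<theta> (Const c) = 0"
proof -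
  have "\<theta> 1 = 0" using DerD(3)[OF assms, of 1 1] by simp
  then show ?thesis using DerD(2)[OF assms, of c 1] by simp
qed

text \<open>Constants are killed and the Leibniz rule propagates agreement from the variables; every
  later identity of derivations is checked this way.\<close>

lemma Der_eqI:
  assumes "\<theta> \<in> Der" "\<eta> \<in> Der" "\<And>i. \<theta> (Var i) = \<eta> (Var i)"
  shows "\<theta> = (\<eta> :: ('v::finite, 'k::field) mpoly \<Rightarrow> _)"
proof
  fix p
  show "\<theta> p = \<eta> p"
    by (induction p rule: mpoly_induct)
      (simp_all add: assms Der_Const DerD(1)[OF assms(1)] DerD(1)[OF assms(2)] DerD(3)[OF assms(1)] DerD(3)[OF assms(2)])
qed

lemma subspace_Der: "der.subspace Der"
  unfolding der.subspace_def by (auto simp: Der_def der_scale_def algebra_simps)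

lemma partial_in_Der: "partial i \<in> Der"
  by (simp add: Der_def partial_add partial_mult)

lemma sum_partial_in_Der: "(\<Sum>i\<in>A. der_scale (f i) (partial i)) \<in> Der"
  by (intro der.subspace_sum der.subspace_scale subspace_Der partial_in_Der)

lemma sum_fun_apply: "(\<Sum>i\<in>A. f i) x = (\<Sum>i\<in>A. f i x)"
  by (induction A rule: infinite_finite_induct) auto

lemma sum_partial_Var:
  "finite A \<Longrightarrow> (\<Sum>i\<in>A. der_scale (f i) (partial i)) (Var j) = (if j \<in> A then f j else 0)"
  by (simp add: sum_fun_apply der_scale_def partial_Var if_distrib[of "\<lambda>x. _ * x"] cong: if_cong)

lemma theta_in_Der: "theta k \<in> Der"
  and theta_sep_in_Der: "theta_sep T C \<in> Der"
  by (simp_all add: theta_def theta_sep_def sum_partial_in_Der)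

lemma theta_Var [simp]: "theta k (Var i) = Var i ^ k"
  by (simp add: theta_def sum_partial_Var)

lemma theta_sep_Var [simp]: "theta_sep T C (Var i) = (if i \<in> C then \<Prod>t\<in>T. Var i - Var t else 0)"
  by (simp add: theta_sep_def sum_partial_Var)

section \<open>Paths, components and separators\<close>

abbreviation reaches :: "'v set \<Rightarrow> 'v set set \<Rightarrow> 'v \<Rightarrow> 'v \<Rightarrow> bool" where
  "reaches V E a b \<equiv> \<exists>p. is_path V E a p b"

lemma reaches_refl: "a \<in> V \<Longrightarrow> reaches V E a a"
  by (intro exI[of _ "[a]"]) (simp add: is_path_def)

lemma reaches_step:
  assumes "reaches V E a b" "{b, c} \<in> E" "c \<in> V"
  shows "reaches V E a c"
proof -
  from assms obtain p where p: "is_path V E a p b" by auto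
  show ?thesis
  proof (cases "c \<in> set p")
    \<comment> \<open>Paths may not repeat vertices, so the path is cut at \<open>c\<close> instead
      of extended.\<close>
    case True
    then obtain xs ys where xs: "p = xs @ c # ys" by (auto dest: split_list)
    have "successively (\<lambda>u v. {u, v} \<in> E) (xs @ [c])"
      using p xs by (auto simp: is_path_def successively_append_iff)
    then have "is_path V E a (xs @ [c]) c"
      using p xs by (cases xs) (auto simp: is_path_def)
    then show ?thesis ..
  next
    case False
    then have "is_path V E a (p @ [c]) c"
      using p assms by (auto simp: is_path_def successively_append_iff)
    then show ?thesis ..
  qed
qed

lemma reaches_induct [consumes 1, case_names refl step]:
  assumes "reaches V E a b"
    and refl: "P a"
    and step: "\<And>u v. P u \<Longrightarrow> u \<in> V \<Longrightarrow> v \<in> V \<Longrightarrow> {u, v} \<in> E \<Longrightarrow> P v"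
  shows "P b"
proof -
  have "P (last p)" if "successively (\<lambda>u v. {u, v} \<in> E) p" "p \<noteq> []" "P (hd p)" "set p \<subseteq> V" for p
    using that
  proof (induction p rule: induct_list012)
    case (3 x y zs)
    then have "P y" using step[of x y] by simp
    then show ?case using 3 by simp
  qed auto
  then show ?thesis using assms by (auto simp: is_path_def)
qed

definition component_of :: "'v set \<Rightarrow> 'v set set \<Rightarrow> 'v \<Rightarrow> 'v set" where
  "component_of V E a = {b \<in> V. reaches V E a b}"

lemma components_eq: "components V E = component_of V E ` V"
  by (auto simp: components_def component_of_def)

lemma in_component_of: "a \<in> V \<Longrightarrow> a \<in> component_of V E a"
  by (simp add: component_of_def reaches_refl)

lemma component_subset: "C \<in> components V E \<Longrightarrow> C \<subseteq> V"
  by (auto simp: components_eq component_of_def)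

lemma component_closed:
  "C \<in> components V E \<Longrightarrow> i \<in> C \<Longrightarrow> {i, j} \<in> E \<Longrightarrow> j \<in> V \<Longrightarrow> j \<in> C"
  unfolding components_eq component_of_def using reaches_step by fastforce

lemma is_path_del_iff:
  "is_path (V - T) (E \<setminus>\<^sub>E T) a p b \<longleftrightarrow> is_path V E a p b \<and> set p \<inter> T = {}"
proof -
  have "successively (\<lambda>u v. {u, v} \<in> E \<setminus>\<^sub>E T) p = successively (\<lambda>u v. {u, v} \<in> E) p"
    if "set p \<inter> T = {}"
    using that by (intro successively_cong) (auto simp: del_edges_def)
  then show ?thesis by (auto simp: is_path_def)
qed

lemma separator_iff:
  "separator V E T \<longleftrightarrow> T \<subseteq> V \<and> (\<exists>a\<in>V - T. \<exists>b\<in>V - T. \<not> reaches (V - T) (E \<setminus>\<^sub>E T) a b)"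
  unfolding separator_def is_path_del_iff by blast

lemma is_path_mono: "is_path V E a p b \<Longrightarrow> E \<subseteq> E' \<Longrightarrow> is_path V E' a p b"
  by (auto simp: is_path_def intro: successively_mono)

lemma separator_antimono: "separator V E' T \<Longrightarrow> E \<subseteq> E' \<Longrightarrow> separator V E T"
  unfolding separator_def by (meson is_path_mono)

section \<open>Separator-based derivations\<close>

definition sep_ders :: "'v::finite set set \<Rightarrow> (('v, 'k::field) mpoly \<Rightarrow> ('v, 'k) mpoly) set" where
  "sep_ders E = {theta_sep T C | T C. separator UNIV E T \<and> C \<in> components (UNIV - T) (E \<setminus>\<^sub>E T)}"

lemma finite_sep_ders: "finite (sep_ders E)"
proof -
  have "sep_ders E \<subseteq> (\<lambda>(T, C). theta_sep T C) ` UNIV"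
    unfolding sep_ders_def by auto
  then show ?thesis by (rule finite_subset) simp
qed

lemma theta_sep_Un:
  "C \<inter> D = {} \<Longrightarrow> theta_sep T (C \<union> D) = theta_sep T C + theta_sep T D"
  by (simp add: theta_sep_def sum.union_disjoint)

text \<open>Such a \<open>U\<close> is a disjoint union of components, which are peeled off one by
  one.\<close>

lemma theta_sep_closed_in_span:
  assumes "separator UNIV E T" "U \<subseteq> UNIV - T"
    and closed: "\<And>i j. i \<in> U \<Longrightarrow> j \<notin> T \<Longrightarrow> {i, j} \<in> E \<Longrightarrow> j \<in> U"
  shows "theta_sep T U \<in> der.span (sep_ders E)" (is "_ \<in> ?S")
  using finite[of U] assms(2) closed
proof (induction U rule: finite_psubset_induct)
  case (psubset U)
  show ?case
  proof (cases "U = {}")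
    case True
    then show ?thesis using der.span_zero[of "sep_ders E"] by (simp add: theta_sep_def zero_fun_def)
  next
    case False
    then obtain a where a: "a \<in> U" by auto
    let ?C = "component_of (UNIV - T) (E \<setminus>\<^sub>E T) a"
    have C: "?C \<in> components (UNIV - T) (E \<setminus>\<^sub>E T)" using a psubset.prems(1) by (auto simp: components_eq)
    have "?C \<subseteq> U"
    proof
      fix b assume "b \<in> ?C"
      then have "reaches (UNIV - T) (E \<setminus>\<^sub>E T) a b" by (simp add: component_of_def)
      then show "b \<in> U"
        using a psubset.prems(2) by (induction rule: reaches_induct) (auto simp: del_edges_def)
    qed
    then have U: "U = ?C \<union> (U - ?C)" by auto
    have "a \<in> ?C" using a psubset.prems(1) by (intro in_component_of) auto
    then have smaller: "U - ?C \<subset> U" using a by auto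
    have closed': "j \<in> U - ?C" if "i \<in> U - ?C" "j \<notin> T" "{i, j} \<in> E" for i j
    proof -
      have "i \<notin> T" using that psubset.prems(1) by auto
      then have "{j, i} \<in> E \<setminus>\<^sub>E T" using that by (auto simp: del_edges_def insert_commute)
      then have "j \<notin> ?C" using component_closed[OF C, of j i] that \<open>i \<notin> T\<close> by auto
      then show ?thesis using psubset.prems(2) that by auto
    qed
    have "theta_sep T (U - ?C) \<in> ?S"
    proof (rule psubset.IH[OF smaller _ closed'])
      show "U - ?C \<subseteq> UNIV - T" using psubset.prems(1) by auto
    qed
    moreover have "theta_sep T ?C \<in> ?S"
      using assms(1) C by (intro der.span_base) (auto simp: sep_ders_def)
    ultimately have "theta_sep T (?C \<union> (U - ?C)) \<in> ?S"
      by (subst theta_sep_Un) (auto intro: der.span_add)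
    then show ?thesis using U by simp
  qed
qed

text \<open>Separators survive the loss of edges, but a component may split into several; hence the
  span on the right.\<close>

lemma sep_ders_antimono:
  assumes "E \<subseteq> E'"
  shows "sep_ders E' \<subseteq> der.span (sep_ders E)"
proof
  fix \<theta> :: "('a, 'b) mpoly \<Rightarrow> ('a, 'b) mpoly"
  assume "\<theta> \<in> sep_ders E'"
  then obtain T C where \<theta>: "\<theta> = theta_sep T C" and sep: "separator UNIV E' T"
    and C: "C \<in> components (UNIV - T) (E' \<setminus>\<^sub>E T)" by (auto simp: sep_ders_def)
  have "j \<in> C" if "i \<in> C" "j \<notin> T" "{i, j} \<in> E" for i j
    using component_closed[OF C \<open>i \<in> C\<close>, of j] component_subset[OF C] that assms
    by (auto simp: del_edges_def)
  then show "\<theta> \<in> der.span (sep_ders E)"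
    unfolding \<theta> using separator_antimono[OF sep assms] component_subset[OF C]
    by (intro theta_sep_closed_in_span) auto
qed

section \<open>Membership in the module of the arrangement\<close>

lemma subspace_D_graphic: "der.subspace (D_graphic E)"
proof -
  have "Var i - Var j dvd (\<theta> + \<eta>) (Var i - Var j)"
    if "Var i - Var j dvd \<theta> (Var i - Var j)" "Var i - Var j dvd \<eta> (Var i - Var j)"
    for i j :: 'a and \<theta> \<eta> :: "('a, 'b) mpoly \<Rightarrow> ('a, 'b) mpoly"
    using that by simp
  then show ?thesis
    using subspace_Der unfolding der.subspace_def D_graphic_def
    by (auto simp: der_scale_def zero_fun_def)
qed

lemma D_graphic_Var_dvd:
  assumes "\<theta> \<in> D_graphic E" "{i, j} \<in> E"
  shows "Var i - Var j dvd \<theta> (Var i) - \<theta> (Var j)"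
  using assms by (auto simp: D_graphic_def Der_diff)

lemma D_graphicI:
  assumes "\<theta> \<in> Der" "\<And>i j. {i, j} \<in> E \<Longrightarrow> Var i - Var j dvd \<theta> (Var i) - \<theta> (Var j)"
  shows "\<theta> \<in> D_graphic E"
  using assms by (auto simp: D_graphic_def Der_diff)

lemma theta_in_D_graphic: "theta k \<in> D_graphic E"
proof (rule D_graphicI[OF theta_in_Der])
  fix i j :: 'a
  show "Var i - Var j dvd theta k (Var i) - theta k (Var j :: ('a, 'b) mpoly)"
  proof (induction k)
    case (Suc k)
    then show ?case by (simp add: dvd_mult_diff_mult)
  qed simp
qed

text \<open>An edge leaving \<open>C\<close> ends in \<open>T\<close>, so its linear form is a
  factor of the product; along an edge inside \<open>C\<close> one polynomial is evaluated at both
  ends.\<close>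

lemma theta_sep_in_D_graphic:
  assumes C: "C \<in> components (UNIV - T) (E \<setminus>\<^sub>E T)"
  shows "theta_sep T C \<in> D_graphic E"
proof (rule D_graphicI[OF theta_sep_in_Der])
  have one: "(Var i :: ('a, 'b) mpoly) - Var j dvd (\<Prod>t\<in>T. Var i - Var t)"
    if "{i, j} \<in> E" "i \<in> C" "j \<notin> C" for i j
  proof -
    have "i \<notin> T" using that component_subset[OF C] by auto
    then have "j \<in> T"
      using component_closed[OF C \<open>i \<in> C\<close>, of j] that by (auto simp: del_edges_def)
    then show ?thesis by (intro dvd_prodI) auto
  qed
  fix i j :: 'a
  assume ij: "{i, j} \<in> E"
  then have ji: "{j, i} \<in> E" by (simp add: insert_commute)
  consider "i \<in> C \<and> j \<in> C" | "i \<in> C \<and> j \<notin> C" | "i \<notin> C \<and> j \<in> C" | "i \<notin> C \<and> j \<notin> C" by blast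
  then show "Var i - Var j dvd theta_sep T C (Var i) - theta_sep T C (Var j :: ('a, 'b) mpoly)"
  proof cases
    case 1
    have "Var i - Var j dvd (\<Prod>t\<in>A. Var i - Var t) - (\<Prod>t\<in>A. Var j - (Var t :: ('a, 'b) mpoly))" if "finite A" for A
      using that by (induction A rule: finite_induct) (simp_all add: dvd_mult_diff_mult)
    then show ?thesis using 1 by simp
  next
    case 2
    then show ?thesis using one ij by simp
  next
    case 3
    then have "Var i - Var j dvd (\<Prod>t\<in>T. Var j - (Var t :: ('a, 'b) mpoly))"
      using one[OF ji] minus_dvd_iff[of "Var i - Var j :: ('a, 'b) mpoly"] by simp
    then show ?thesis using 3 by simp
  qed simp
qed

section \<open>Polynomial interpolation of derivations\<close>

lemma dvd_poly_diff: "(x - y :: 'a::comm_ring_1) dvd poly P x - poly P y"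
proof (induction P)
  case (pCons c P)
  then show ?case by (simp add: dvd_mult_diff_mult)
qed simp

lemma poly_eq_sum_lessThan:
  fixes P :: "'a::comm_ring_1 poly"
  assumes "\<And>n. N \<le> n \<Longrightarrow> coeff P n = 0"
  shows "poly P x = (\<Sum>n<N. coeff P n * x ^ n)"
proof -
  have "coeff P n = 0" if "n \<notin> {..<N}" for n using that assms by simp
  then have "(\<Sum>n\<le>degree P. coeff P n * x ^ n) = (\<Sum>n<N. coeff P n * x ^ n)"
    by (intro sum.mono_neutral_cong) (auto simp: coeff_eq_0)
  then show ?thesis by (simp add: poly_altdef)
qed

definition root_poly :: "('a \<Rightarrow> 'b::comm_ring_1) \<Rightarrow> 'a set \<Rightarrow> 'b poly" where
  "root_poly r W = (\<Prod>i\<in>W. [:- r i, 1:])"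

lemma poly_root_poly [simp]: "poly (root_poly r W) x = (\<Prod>i\<in>W. x - r i)"
  by (simp add: root_poly_def poly_prod)

lemma coeff_root_poly:
  assumes "finite W"
  shows "coeff (root_poly r W) (card W) = 1 \<and> (\<forall>n>card W. coeff (root_poly r W) n = 0)"
  using assms
proof (induction W rule: finite_induct)
  case (insert i W)
  have step: "coeff (root_poly r (insert i W)) (Suc n) = - r i * coeff (root_poly r W) (Suc n) + coeff (root_poly r W) n" for n
    using insert.hyps by (simp add: root_poly_def)
  have "coeff (root_poly r (insert i W)) n = 0" if "n > Suc (card W)" for n
    using that insert.IH step[of "n - 1"] by (cases n) auto
  then show ?case using insert step[of "card W"] by simp
qed (auto simp: root_poly_def)

text \<open>The coefficients of \<open>P\<close> lie in the polynomial ring itself and serve as the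
  scalars in front of \<open>theta n\<close>.\<close>

lemma Der_poly_in_span:
  fixes \<theta> :: "('v::finite, 'k::field) mpoly \<Rightarrow> ('v, 'k) mpoly"
  assumes "\<theta> \<in> Der" "\<And>i. \<theta> (Var i) = poly P (Var i)" "\<And>n. N \<le> n \<Longrightarrow> coeff P n = 0"
  shows "\<theta> \<in> der.span (theta ` {..<N})"
proof -
  have "\<theta> = (\<Sum>n<N. der_scale (coeff P n) (theta n))"
  proof (rule Der_eqI)
    show "(\<Sum>n<N. der_scale (coeff P n) (theta n)) \<in> Der"
      by (intro der.subspace_sum der.subspace_scale subspace_Der theta_in_Der)
    show "\<theta> (Var i) = (\<Sum>n<N. der_scale (coeff P n) (theta n)) (Var i)" for i
      using poly_eq_sum_lessThan[of N P, OF assms(3)]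
      by (simp add: assms(2) sum_fun_apply der_scale_def)
  qed (fact assms(1))
  also have "\<dots> \<in> der.span (theta ` {..<N})"
    by (intro der.span_sum der.span_scale der.span_base) simp
  finally show ?thesis .
qed

text \<open>A new node \<open>a\<close> is met by adding a multiple of
  \<open>root_poly Var W\<close>, which vanishes at the old nodes; the divisibility hypotheses make
  the divided difference \<open>g\<close> a polynomial.\<close>

lemma Newton_interpolation:
  fixes f :: "'v::finite \<Rightarrow> ('v, 'k::comm_ring_1) mpoly"
  assumes "\<And>i j. i \<noteq> j \<Longrightarrow> Var i - Var j dvd f i - f j"
  shows "\<exists>P. (\<forall>i\<in>W. f i = poly P (Var i)) \<and> (\<forall>n\<ge>card W. coeff P n = 0)"
  using finite[of W]
proof (induction W rule: finite_induct)
  case empty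
  show ?case by (intro exI[of _ 0]) simp
next
  case (insert a W)
  then obtain P where P: "\<forall>i\<in>W. f i = poly P (Var i)" "\<forall>n\<ge>card W. coeff P n = 0" by blast
  have "Var a - Var b dvd f a - poly P (Var a)" if "b \<in> W" for b
  proof -
    have "a \<noteq> b" using that insert.hyps by auto
    then have "Var a - Var b dvd (f a - f b) - (poly P (Var a) - poly P (Var b))"
      by (intro dvd_diff[of "Var a - Var b"] assms dvd_poly_diff)
    then show ?thesis using P that by simp
  qed
  then have "(\<Prod>b\<in>W. Var a - Var b) dvd f a - poly P (Var a)"
    by (intro prod_Var_diff_dvd insert.hyps)
  then obtain g where g: "f a - poly P (Var a) = (\<Prod>b\<in>W. Var a - Var b) * g" ..
  let ?Q = "P + smult g (root_poly Var W)"
  have "f i = poly ?Q (Var i)" if "i \<in> insert a W" for i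
  proof (cases "i = a")
    case True
    then show ?thesis using g by (simp add: algebra_simps)
  next
    case False
    then have "(\<Prod>b\<in>W. Var i - Var b :: ('v, 'k) mpoly) = 0"
      using that by (intro prod_zero) auto
    then show ?thesis using False that P by simp
  qed
  moreover have "coeff ?Q n = 0" if "n \<ge> card (insert a W)" for n
    using that P(2) insert.hyps by (simp add: coeff_root_poly Suc_le_eq)
  ultimately show ?case by blast
qed

section \<open>Generators\<close>

lemma D_graphic_complete:
  fixes E :: "'v::finite set set"
  assumes "\<And>i j. i \<noteq> j \<Longrightarrow> {i, j} \<in> E"
  shows "D_graphic E \<subseteq> der.span (theta ` {..<card (UNIV :: 'v set)} :: (('v, 'k::field) mpoly \<Rightarrow> ('v, 'k) mpoly) set)"
proof
  fix \<theta> :: "('v, 'k) mpoly \<Rightarrow> ('v, 'k) mpoly"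
  assume \<theta>: "\<theta> \<in> D_graphic E"
  have "\<exists>P. (\<forall>i\<in>UNIV. \<theta> (Var i) = poly P (Var i)) \<and> (\<forall>n\<ge>card (UNIV :: 'v set). coeff P n = 0)"
    using assms by (intro Newton_interpolation D_graphic_Var_dvd[OF \<theta>])
  then show "\<theta> \<in> der.span (theta ` {..<card (UNIV :: 'v set)})"
    using \<theta> by (auto simp: D_graphic_def intro!: Der_poly_in_span)
qed

text \<open>The monomial prime ideal generated by the variables in \<open>W\<close>, described by
  exponents so that membership in several such ideals can be tested monomial by monomial.\<close>

definition var_ideal :: "'v set \<Rightarrow> ('v, 'k::comm_ring_1) mpoly set" where
  "var_ideal W = {p. \<forall>m\<in>Poly_Mapping.keys p. \<exists>t\<in>W. Poly_Mapping.lookup m t \<noteq> 0}"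

lemma var_ideal_0: "0 \<in> var_ideal W"
  by (simp add: var_ideal_def)

lemma var_ideal_add: "p \<in> var_ideal W \<Longrightarrow> q \<in> var_ideal W \<Longrightarrow> p + q \<in> var_ideal W"
  using keys_add[of p q] by (auto simp: var_ideal_def)

lemma var_ideal_diff: "p \<in> var_ideal W \<Longrightarrow> q \<in> var_ideal W \<Longrightarrow> p - q \<in> var_ideal W"
  using keys_diff[of p q] by (auto simp: var_ideal_def)

lemma var_ideal_mult:
  assumes "p \<in> var_ideal W"
  shows "p * q \<in> var_ideal W"
  unfolding var_ideal_def
proof (intro CollectI ballI)
  fix m assume "m \<in> Poly_Mapping.keys (p * q)"
  then obtain k l where "m = k + l" "k \<in> Poly_Mapping.keys p" using keys_mult[of p q] by auto
  then show "\<exists>t\<in>W. Poly_Mapping.lookup m t \<noteq> 0"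
    using assms by (fastforce simp: var_ideal_def lookup_add)
qed

lemma Var_in_var_ideal: "t \<in> W \<Longrightarrow> Var t \<in> var_ideal W"
  by (auto simp: var_ideal_def Var_def lookup_single intro!: bexI[of _ t])

text \<open>
  The substitutions \<open>\<psi>\<close> and \<open>\<beta>\<close> restrict to the hyperplane \<open>x\<^sub>a = x\<^sub>b\<close> and change to the coordinates
  \<open>x\<^sub>a - x\<^sub>t\<close>, in which the possible values of \<open>\<theta> (x\<^sub>a - x\<^sub>b)\<close> form a monomial ideal.
\<close>

lemma D_graphic_add_edge:
  fixes \<theta> :: "('v::finite, 'k::field) mpoly \<Rightarrow> ('v, 'k) mpoly"
  assumes ab: "a \<noteq> b" "{a, b} \<notin> E" and \<theta>: "\<theta> \<in> D_graphic E"
  shows "\<exists>\<eta>\<in>der.span (sep_ders E). \<theta> - \<eta> \<in> D_graphic (insert {a, b} E)"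
proof -
  define \<psi> :: "'v \<Rightarrow> ('v, 'k) mpoly" where "\<psi> t = (if t = a \<or> t = b then Var a else Var a - Var t)" for t
  define \<beta> :: "'v \<Rightarrow> ('v, 'k) mpoly" where "\<beta> t = (if t = a then Var a else Var a - Var t)" for t
  define f where "f i = \<theta> (Var i)" for i
  define h where "h = mpoly_subst \<psi> (f a - f b)"
  \<comment> \<open>The ideal of values on \<open>Var a - Var b\<close>, modulo that form, attained
    by combinations of separator-based derivations.\<close>
  define I where "I = {g. \<exists>\<eta>\<in>der.span (sep_ders E). Var a - Var b dvd g - (\<eta> (Var a) - \<eta> (Var b) :: ('v, 'k) mpoly)}"

  have I_0: "0 \<in> I"
    unfolding I_def by (auto intro!: bexI[OF _ der.span_zero])
  have I_add: "p + q \<in> I" if pI: "p \<in> I" and qI: "q \<in> I" for p q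
  proof -
    obtain \<eta> where \<eta>: "\<eta> \<in> der.span (sep_ders E)" "Var a - Var b dvd p - (\<eta> (Var a) - \<eta> (Var b))"
      using pI by (auto simp: I_def)
    obtain \<zeta> where \<zeta>: "\<zeta> \<in> der.span (sep_ders E)" "Var a - Var b dvd q - (\<zeta> (Var a) - \<zeta> (Var b))"
      using qI by (auto simp: I_def)
    have "p + q - ((\<eta> + \<zeta>) (Var a) - (\<eta> + \<zeta>) (Var b))
        = (p - (\<eta> (Var a) - \<eta> (Var b))) + (q - (\<zeta> (Var a) - \<zeta> (Var b)))" by simp
    then have "Var a - Var b dvd p + q - ((\<eta> + \<zeta>) (Var a) - (\<eta> + \<zeta>) (Var b))"
      using dvd_add[OF \<eta>(2) \<zeta>(2)] by (simp only:)
    then show ?thesis unfolding I_def using der.span_add[OF \<eta>(1) \<zeta>(1)] by blast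
  qed
  have I_mult: "p * r \<in> I" if pI: "p \<in> I" for p r
  proof -
    obtain \<eta> where \<eta>: "\<eta> \<in> der.span (sep_ders E)" "Var a - Var b dvd p - (\<eta> (Var a) - \<eta> (Var b))"
      using pI by (auto simp: I_def)
    have "p * r - (der_scale r \<eta> (Var a) - der_scale r \<eta> (Var b))
        = (p - (\<eta> (Var a) - \<eta> (Var b))) * r" by (simp add: der_scale_def algebra_simps)
    then have "Var a - Var b dvd p * r - (der_scale r \<eta> (Var a) - der_scale r \<eta> (Var b))"
      using dvd_mult2[OF \<eta>(2)] by (simp only:)
    then show ?thesis unfolding I_def using der.span_scale[OF \<eta>(1)] by blast
  qed

  \<comment> \<open>Along each edge of the path the values of \<open>f\<close> differ by a multiple
    of the edge form, which \<psi> sends into the ideal of the inner vertices. Telescoping from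
    \<open>a\<close> to \<open>b\<close> puts \<open>h\<close> there, for every path.\<close>
  have meets: "set p \<inter> ({t. Poly_Mapping.lookup m t \<noteq> 0} - {a, b}) \<noteq> {}"
    if m: "m \<in> Poly_Mapping.keys h" and p: "is_path UNIV E a p b" for m p
  proof -
    define W where "W = set p - {a, b}"
    have edge: "mpoly_subst \<psi> (f u) - mpoly_subst \<psi> (f v) \<in> var_ideal W"
      if "u \<in> set p" "v \<in> set p" "{u, v} \<in> E" for u v
    proof -
      obtain q where q: "f u - f v = (Var u - Var v) * q"
        using D_graphic_Var_dvd[OF \<theta> \<open>{u, v} \<in> E\<close>] by (auto simp: f_def elim: dvdE)
      have "\<psi> u - \<psi> v \<in> var_ideal W"
      proof (cases "u \<in> {a, b}"; cases "v \<in> {a, b}")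
        assume "u \<in> {a, b}" "v \<in> {a, b}"
        then have "\<psi> u - \<psi> v = 0" by (auto simp: \<psi>_def)
        then show ?thesis by (simp add: var_ideal_0)
      next
        assume "u \<in> {a, b}" "v \<notin> {a, b}"
        then have "\<psi> u - \<psi> v = Var v" "v \<in> W" using that by (auto simp: \<psi>_def W_def)
        then show ?thesis by (simp add: Var_in_var_ideal)
      next
        assume "u \<notin> {a, b}" "v \<in> {a, b}"
        then have "\<psi> u - \<psi> v = 0 - Var u" "u \<in> W" using that by (auto simp: \<psi>_def W_def)
        then show ?thesis by (simp only: Var_in_var_ideal var_ideal_diff var_ideal_0)
      next
        assume "u \<notin> {a, b}" "v \<notin> {a, b}"
        then have "\<psi> u - \<psi> v = Var v - Var u" "u \<in> W" "v \<in> W" using that by (auto simp: \<psi>_def W_def)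
        then show ?thesis by (simp only: Var_in_var_ideal var_ideal_diff)
      qed
      then have "(\<psi> u - \<psi> v) * mpoly_subst \<psi> q \<in> var_ideal W" by (rule var_ideal_mult)
      moreover have "mpoly_subst \<psi> (f u) - mpoly_subst \<psi> (f v) = (\<psi> u - \<psi> v) * mpoly_subst \<psi> q"
        using arg_cong[OF q, of "mpoly_subst \<psi>"] by simp
      ultimately show ?thesis by simp
    qed
    have "mpoly_subst \<psi> (f (hd xs)) - mpoly_subst \<psi> (f (last xs)) \<in> var_ideal W"
      if "successively (\<lambda>u v. {u, v} \<in> E) xs" "xs \<noteq> []" "set xs \<subseteq> set p" for xs
      using that
    proof (induction xs rule: induct_list012)
      case (3 x y zs)
      have "mpoly_subst \<psi> (f x) - mpoly_subst \<psi> (f y) \<in> var_ideal W"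
        using 3 by (intro edge) auto
      moreover have "mpoly_subst \<psi> (f y) - mpoly_subst \<psi> (f (last (y # zs))) \<in> var_ideal W"
        using 3 by simp
      ultimately show ?case using var_ideal_add by fastforce
    qed (simp_all add: var_ideal_0)
    from this[of p] have "h \<in> var_ideal W" using p by (simp add: is_path_def h_def)
    then show ?thesis using m by (auto simp: var_ideal_def W_def)
  qed

  \<comment> \<open>The support of \<open>m\<close> outside \<open>a\<close> and \<open>b\<close>
    meets every path, so it is a separator \<open>T\<close>. With \<open>C\<close> the component of
    \<open>a\<close>, \<open>theta_sep T C\<close> takes the product as value at \<open>a\<close>
    and zero at \<open>b\<close>.\<close>
  have monomial: "mpoly_subst \<beta> (Poly_Mapping.single m c) \<in> I" if m: "m \<in> Poly_Mapping.keys h" for m c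
  proof -
    define T where "T = {t. Poly_Mapping.lookup m t \<noteq> 0} - {a, b}"
    define C where "C = component_of (UNIV - T) (E \<setminus>\<^sub>E T) a"
    have T: "a \<in> UNIV - T" "b \<in> UNIV - T" by (auto simp: T_def)
    have sep: "separator UNIV E T"
      unfolding separator_def using T meets[OF m] by (auto simp: T_def)
    have "b \<notin> C"
      using meets[OF m] by (auto simp: C_def component_of_def is_path_del_iff T_def)
    moreover have "a \<in> C" unfolding C_def by (rule in_component_of[OF T(1)])
    moreover have "theta_sep T C \<in> sep_ders E"
      using sep T by (auto simp: sep_ders_def C_def components_eq)
    ultimately have "(\<Prod>t\<in>T. Var a - Var t) \<in> I"
      unfolding I_def by (auto intro!: bexI[OF _ der.span_base])
    moreover have "(\<Prod>t\<in>T. Var a - Var t) dvd (\<Prod>t\<in>UNIV. \<beta> t ^ Poly_Mapping.lookup m t)"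
      by (rule prod_dvd_prod_subset2) (auto simp: T_def \<beta>_def intro: dvd_power)
    then have "(\<Prod>t\<in>T. Var a - Var t) dvd mpoly_subst \<beta> (Poly_Mapping.single m c)"
      by (simp add: mpoly_subst_single)
    ultimately show ?thesis using I_mult by (auto elim!: dvdE)
  qed
  have "(\<Sum>m\<in>A. mpoly_subst \<beta> (Poly_Mapping.single m (Poly_Mapping.lookup h m))) \<in> I"
    if "finite A" "A \<subseteq> Poly_Mapping.keys h" for A
    using that by (induction A rule: finite_induct) (simp_all add: I_0 I_add monomial)
  then have "mpoly_subst \<beta> (\<Sum>m\<in>Poly_Mapping.keys h. Poly_Mapping.single m (Poly_Mapping.lookup h m)) \<in> I"
    by simp
  then have "mpoly_subst \<beta> h \<in> I"
    by (simp only: mpoly_eq_sum_monomials[of h, symmetric])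
  \<comment> \<open>The substitution \<beta> undoes \<psi> except that \<open>b\<close> stays merged
    into \<open>a\<close>.\<close>
  moreover have "(\<lambda>i. mpoly_subst \<beta> (\<psi> i)) = Var(b := Var a)"
    using ab by (auto simp: \<psi>_def \<beta>_def)
  ultimately have "merge a b (f a - f b) \<in> I"
    by (simp only: h_def merge_def mpoly_subst_comp)
  then obtain \<eta> where \<eta>: "\<eta> \<in> der.span (sep_ders E)"
    and dvd: "Var a - Var b dvd merge a b (f a - f b) - (\<eta> (Var a) - \<eta> (Var b))"
    by (auto simp: I_def)
  \<comment> \<open>Replacing \<open>f a - f b\<close> by its restriction costs only a multiple of
    \<open>Var a - Var b\<close>.\<close>
  have "f a - f b - merge a b (f a - f b) + (merge a b (f a - f b) - (\<eta> (Var a) - \<eta> (Var b)))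
      = (\<theta> - \<eta>) (Var a) - (\<theta> - \<eta>) (Var b)" by (simp add: f_def)
  then have dvd': "Var a - Var b dvd (\<theta> - \<eta>) (Var a) - (\<theta> - \<eta>) (Var b)"
    using dvd_add[OF dvd_diff_merge[of a b "f a - f b"] dvd] by (simp only:)
  have "sep_ders E \<subseteq> D_graphic E"
    by (auto simp: sep_ders_def theta_sep_in_D_graphic)
  then have "\<eta> \<in> D_graphic E"
    using \<eta> der.span_minimal[OF _ subspace_D_graphic] by blast
  then have diff: "\<theta> - \<eta> \<in> D_graphic E"
    using \<theta> by (intro der.subspace_diff subspace_D_graphic)
  have "\<theta> - \<eta> \<in> D_graphic (insert {a, b} E)"
  proof (rule D_graphicI)
    show "\<theta> - \<eta> \<in> Der" using diff by (simp add: D_graphic_def)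
    fix i j assume "{i, j} \<in> insert {a, b} E"
    then consider "{i, j} \<in> E" | "i = a" "j = b" | "i = b" "j = a"
      by (auto simp: doubleton_eq_iff)
    then show "Var i - Var j dvd (\<theta> - \<eta>) (Var i) - (\<theta> - \<eta>) (Var j)"
    proof cases
      case 1
      then show ?thesis by (rule D_graphic_Var_dvd[OF diff])
    next
      case 2
      then show ?thesis using dvd' by simp
    next
      case 3
      have "- (Var a - Var b) dvd - ((\<theta> - \<eta>) (Var a) - (\<theta> - \<eta>) (Var b))"
        using dvd' by (simp only: dvd_minus_iff minus_dvd_iff)
      then show ?thesis using 3 by simp
    qed
  qed
  then show ?thesis using \<eta> by blast
qed

text \<open>One missing edge is added at a time; \<open>sep_ders_antimono\<close> carries the
  separator-based generators of the larger graph back to \<open>E\<close>.\<close>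

lemma D_graphic_subset_span:
  fixes E :: "'v::finite set set"
  shows "D_graphic E \<subseteq> der.span (theta ` {..<card (UNIV :: 'v set)} \<union> sep_ders E :: (('v, 'k::field) mpoly \<Rightarrow> ('v, 'k) mpoly) set)"
proof (induction "card ({e. \<exists>i j. i \<noteq> j \<and> e = {i, j}} - E)" arbitrary: E rule: less_induct)
  case less
  show ?case
  proof (cases "\<forall>i j. i \<noteq> j \<longrightarrow> {i, j} \<in> E")
    case True
    then have "D_graphic E \<subseteq> der.span (theta ` {..<card (UNIV :: 'v set)} :: (('v, 'k) mpoly \<Rightarrow> ('v, 'k) mpoly) set)"
      by (intro D_graphic_complete) auto
    then show ?thesis using der.span_mono[of "theta ` {..<card (UNIV :: 'v set)}"] by blast
  next
    case False
    then obtain a b where ab: "a \<noteq> b" "{a, b} \<notin> E" by blast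
    let ?E = "insert {a, b} E"
    let ?S = "der.span (theta ` {..<card (UNIV :: 'v set)} \<union> sep_ders E :: (('v, 'k) mpoly \<Rightarrow> ('v, 'k) mpoly) set)"
    have "card ({e. \<exists>i j. i \<noteq> j \<and> e = {i, j}} - ?E) < card ({e. \<exists>i j. i \<noteq> j \<and> e = {i, j}} - E)"
      using ab by (intro psubset_card_mono) auto
    then have IH: "D_graphic ?E \<subseteq> der.span (theta ` {..<card (UNIV :: 'v set)} \<union> sep_ders ?E :: (('v, 'k) mpoly \<Rightarrow> ('v, 'k) mpoly) set)"
      by (rule less)
    have sep: "der.span (sep_ders E) \<subseteq> ?S" by (intro der.span_mono) auto
    have "theta ` {..<card (UNIV :: 'v set)} \<union> sep_ders ?E \<subseteq> ?S"
      using sep sep_ders_antimono[of E ?E] by (auto intro: der.span_base)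
    then have sub: "der.span (theta ` {..<card (UNIV :: 'v set)} \<union> sep_ders ?E) \<subseteq> ?S"
      by (rule der.span_minimal) simp
    show ?thesis
    proof
      fix \<theta> :: "('v, 'k) mpoly \<Rightarrow> ('v, 'k) mpoly"
      assume "\<theta> \<in> D_graphic E"
      then obtain \<eta> where "\<eta> \<in> der.span (sep_ders E)" "\<theta> - \<eta> \<in> D_graphic ?E"
        using D_graphic_add_edge[OF ab] by blast
      then have "\<eta> \<in> ?S" "\<theta> - \<eta> \<in> ?S" using sep IH sub by auto
      then have "(\<theta> - \<eta>) + \<eta> \<in> ?S" by (intro der.span_add)
      then show "\<theta> \<in> ?S" by simp
    qed
  qed
qed

text \<open>For \<open>k\<close> above \<open>d\<close>, a derivation in the span acts on all
  variables by one monic polynomial of degree \<open>k\<close>; its lower terms are covered by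
  induction.\<close>

lemma theta_in_span_sep:
  fixes E :: "'v::finite set set"
  assumes ab: "a \<notin> X" "b \<notin> X" "\<not> reaches (UNIV - X) (E \<setminus>\<^sub>E X) a b" and card: "card X \<le> d"
    and k: "k < card (UNIV :: 'v set)"
  shows "(theta k :: ('v, 'k::field) mpoly \<Rightarrow> ('v, 'k) mpoly) \<in> der.span (theta ` {0..d} \<union> sep_ders E)"
    (is "_ \<in> ?S")
  using k
proof (induction k rule: less_induct)
  case (less k)
  have sep_span: "der.span (sep_ders E) \<subseteq> ?S" by (intro der.span_mono) auto
  have lower: "der.span (theta ` {..<k}) \<subseteq> ?S"
    using less by (intro der.span_minimal) auto
  have "a \<noteq> b" using ab reaches_refl[of a "UNIV - X" "E \<setminus>\<^sub>E X"] by auto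
  have sep: "separator UNIV E T" if "X \<subseteq> T" "a \<notin> T" "b \<notin> T" for T
    using that ab unfolding separator_def is_path_del_iff by blast
  have monic: "theta k \<in> ?S" if "\<eta> \<in> ?S" "card T = k" "\<eta> \<in> Der" "\<And>i. \<eta> (Var i) = (\<Prod>t\<in>T. Var i - Var t)" for T \<eta>
  proof -
    have "theta k - \<eta> \<in> der.span (theta ` {..<k})"
    proof (rule Der_poly_in_span)
      show "theta k - \<eta> \<in> Der" by (intro der.subspace_diff subspace_Der theta_in_Der that)
      show "(theta k - \<eta>) (Var i) = poly (monom 1 k - root_poly Var T) (Var i)" for i
        by (simp add: that poly_monom)
      show "coeff (monom 1 k - root_poly Var T) n = (0 :: ('v, 'k) mpoly)" if "k \<le> n" for n
        using coeff_root_poly[of T "Var :: 'v \<Rightarrow> ('v, 'k) mpoly"] \<open>card T = k\<close> that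
        by (cases "n = k") auto
    qed
    then have "(theta k - \<eta>) + \<eta> \<in> ?S" using lower that by (intro der.span_add) auto
    then show ?thesis by simp
  qed
  consider "k \<le> d" | "d < k" "k + 2 \<le> card (UNIV :: 'v set)" | "k + 1 = card (UNIV :: 'v set)" using less.prems by linarith
  then show ?case
  proof cases
    case 1
    then show ?thesis by (intro der.span_base) auto
  next
    case 2
    have "card (UNIV - {a, b}) = card (UNIV :: 'v set) - 2" using \<open>a \<noteq> b\<close> by (simp add: card_Diff_subset)
    then have "k \<le> card (UNIV - {a, b})" "card X \<le> k" "X \<subseteq> UNIV - {a, b}"
      using 2 card ab(1,2) by auto
    then obtain T where T: "X \<subseteq> T" "T \<subseteq> UNIV - {a, b}" "card T = k"
      using exists_subset_between[of X k "UNIV - {a, b}"] by (metis finite)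
    \<comment> \<open>The product over \<open>T\<close> vanishes at the variables of
      \<open>T\<close>, so taking all components together yields the same polynomial at every
      variable.\<close>
    have "theta_sep T (UNIV - T) \<in> der.span (sep_ders E)"
      using sep T by (intro theta_sep_closed_in_span) auto
    then show ?thesis
      using sep_span T(3) by (intro monic[of "theta_sep T (UNIV - T)" T]) (auto simp: theta_sep_in_Der intro!: prod_zero)
  next
    case 3
    \<comment> \<open>A separator leaves out two vertices, so none has size \<open>k\<close>. The
      factor \<open>Var a - Var b\<close> supplies the missing degree, giving the root polynomial of
      \<open>UNIV - {a}\<close>, which vanishes at all variables but \<open>Var a\<close>.\<close>
    let ?T = "UNIV - {a, b}"
    let ?\<eta> = "der_scale (Var a - Var b) (theta_sep ?T {a}) :: ('v, 'k) mpoly \<Rightarrow> ('v, 'k) mpoly"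
    have "{a, b} \<notin> E"
      using ab reaches_step[of "UNIV - X" "E \<setminus>\<^sub>E X" a a b] reaches_refl[of a "UNIV - X" "E \<setminus>\<^sub>E X"]
      by (auto simp: del_edges_def)
    then have "theta_sep ?T {a} \<in> der.span (sep_ders E)"
      using \<open>a \<noteq> b\<close> ab by (intro theta_sep_closed_in_span sep) (auto simp: insert_commute)
    then have "?\<eta> \<in> ?S" using sep_span by (intro der.span_scale) auto
    moreover have "card (UNIV - {a}) = k" using 3 by (simp add: card_Diff_singleton)
    moreover have "?\<eta> (Var i) = (\<Prod>t\<in>UNIV - {a}. Var i - Var t)" for i
    proof (cases "i = a")
      case True
      have "UNIV - {a} = insert b ?T" using \<open>a \<noteq> b\<close> by auto
      then show ?thesis using True by (simp add: der_scale_def)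
    next
      case False
      then have "(\<Prod>t\<in>UNIV - {a}. Var i - Var t :: ('v, 'k) mpoly) = 0"
        by (intro prod_zero) auto
      then show ?thesis using False by (simp add: der_scale_def)
    qed
    ultimately show ?thesis
      by (intro monic[of ?\<eta>]) (auto intro: der.subspace_scale subspace_Der theta_sep_in_Der)
  qed
qed

section \<open>Homogeneous components\<close>

definition mdeg :: "('v::finite \<Rightarrow>\<^sub>0 nat) \<Rightarrow> nat" where
  "mdeg m = (\<Sum>i\<in>UNIV. Poly_Mapping.lookup m i)"

lemma mdeg_add: "mdeg (m + n) = mdeg m + mdeg n"
  by (simp add: mdeg_def lookup_add sum.distrib)

lemma mdeg_eq_0_iff: "mdeg m = 0 \<longleftrightarrow> m = 0"
  by (auto simp: mdeg_def intro: poly_mapping_eqI)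

definition homogeneous :: "nat \<Rightarrow> ('v::finite, 'k::comm_ring_1) mpoly \<Rightarrow> bool" where
  "homogeneous d p \<longleftrightarrow> (\<forall>m\<in>Poly_Mapping.keys p. mdeg m = d)"

lemma homogeneous_0: "homogeneous d 0"
  by (simp add: homogeneous_def)

lemma homogeneous_1: "homogeneous 0 1"
  by (simp add: homogeneous_def mdeg_def)

lemma homogeneous_Var: "homogeneous 1 (Var i)"
  by (simp add: homogeneous_def Var_def mdeg_def lookup_single when_def)

lemma homogeneous_diff: "homogeneous d p \<Longrightarrow> homogeneous d q \<Longrightarrow> homogeneous d (p - q)"
  using keys_diff[of p q] by (auto simp: homogeneous_def)

lemma homogeneous_mult: "homogeneous d p \<Longrightarrow> homogeneous e q \<Longrightarrow> homogeneous (d + e) (p * q)"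
  using keys_mult[of p q] by (fastforce simp: homogeneous_def mdeg_add)

lemma homogeneous_Var_power: "homogeneous k (Var i ^ k)"
proof (induction k)
  case (Suc k)
  then show ?case using homogeneous_mult[OF homogeneous_Var[of i] Suc] by simp
qed (simp add: homogeneous_1)

lemma homogeneous_prod_linear:
  "finite T \<Longrightarrow> homogeneous (card T) (\<Prod>t\<in>T. Var i - Var t :: ('v::finite, 'k::comm_ring_1) mpoly)"
proof (induction T rule: finite_induct)
  case (insert t T)
  have "homogeneous (1 + card T) ((Var i - Var t) * (\<Prod>t\<in>T. Var i - Var t :: ('v, 'k) mpoly))"
    by (intro homogeneous_mult homogeneous_diff homogeneous_Var insert)
  then show ?case using insert.hyps by simp
qed (simp add: homogeneous_1)

definition hcomp :: "nat \<Rightarrow> ('v::finite, 'k::comm_ring_1) mpoly \<Rightarrow> ('v, 'k) mpoly" where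
  "hcomp d p = (\<Sum>m\<in>{m \<in> Poly_Mapping.keys p. mdeg m = d}. Poly_Mapping.single m (Poly_Mapping.lookup p m))"

lemma lookup_hcomp: "Poly_Mapping.lookup (hcomp d p) m = (if mdeg m = d then Poly_Mapping.lookup p m else 0)"
  by (simp add: hcomp_def lookup_sum lookup_single when_def in_keys_iff)

lemma hcomp_add: "hcomp d (p + q) = hcomp d p + hcomp d q"
  by (rule poly_mapping_eqI) (simp add: lookup_hcomp lookup_add)

lemma hcomp_0: "hcomp d 0 = 0"
  by (rule poly_mapping_eqI) (simp add: lookup_hcomp)

lemma hcomp_sum: "hcomp d (\<Sum>i\<in>A. f i) = (\<Sum>i\<in>A. hcomp d (f i))"
  by (induction A rule: infinite_finite_induct) (simp_all add: hcomp_0 hcomp_add)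

lemma hcomp_homogeneous: "homogeneous n p \<Longrightarrow> hcomp d p = (if n = d then p else 0)"
  by (rule poly_mapping_eqI) (auto simp: lookup_hcomp homogeneous_def in_keys_iff)

text \<open>Both sides are additive in \<open>p\<close>, so monomials suffice. The case split guards
  the truncated \<open>d - n\<close>.\<close>

lemma hcomp_mult_homogeneous:
  assumes "homogeneous n q"
  shows "hcomp d (p * q) = (if n \<le> d then hcomp (d - n) p * q else 0)"
proof (induction p rule: mpoly_monomial_induct)
  case (monomial m c)
  have m: "homogeneous (mdeg m) (Poly_Mapping.single m c)" by (simp add: homogeneous_def)
  show ?case
    unfolding hcomp_homogeneous[OF m] hcomp_homogeneous[OF homogeneous_mult[OF m assms]] by auto
next
  case (add p p')
  then show ?case by (simp add: distrib_right hcomp_add)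
qed

lemma hcomp_0_eq_Const: "hcomp 0 p = Const (Poly_Mapping.lookup p 0)"
  by (rule poly_mapping_eqI)
    (auto simp: lookup_hcomp mdeg_eq_0_iff Const_def lookup_single when_def)

section \<open>Minimality\<close>

text \<open>The root count for a monic polynomial: synthetic division removes one root, and the
  other roots pass to the quotient because their differences to it can be cancelled.\<close>

lemma card_roots_le:
  fixes Q :: "'a::comm_ring_1 poly"
  assumes "coeff Q k = 1" "\<And>n. k < n \<Longrightarrow> coeff Q n = 0" "finite W"
    and "\<And>i. i \<in> W \<Longrightarrow> poly Q (r i) = 0"
    and "\<And>i j. i \<in> W \<Longrightarrow> j \<in> W \<Longrightarrow> i \<noteq> j \<Longrightarrow> nzdiv (r i - r j)"
  shows "card W \<le> k"
  using assms
proof (induction k arbitrary: Q W)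
  case 0
  have "Q = [:1:]"
    using 0(1,2) by (intro poly_eqI) (auto simp: coeff_pCons split: nat.split)
  then have "W = {}" using 0(4) by auto
  then show ?case by simp
next
  case (Suc k)
  show ?case
  proof (cases "W = {}")
    case False
    then obtain a where a: "a \<in> W" by auto
    define P where "P = synthetic_div Q (r a)"
    have Q: "Q = [:- r a, 1:] * P"
      using synthetic_div_correct'[of "r a" Q] Suc.prems(4)[OF a] by (simp add: P_def)
    have "degree Q \<le> Suc k"
      using Suc.prems(2) by (intro degree_le) auto
    then have "degree P \<le> k" by (simp add: P_def degree_synthetic_div)
    then have P: "coeff P n = 0" if "k < n" for n using that by (intro coeff_eq_0) auto
    have "coeff Q (Suc k) = - r a * coeff P (Suc k) + coeff P k" by (simp add: Q)
    then have "coeff P k = 1" using P Suc.prems(1) by simp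
    moreover have "poly P (r i) = 0" if "i \<in> W - {a}" for i
    proof (rule nzdivD)
      show "nzdiv (r i - r a)" using that a Suc.prems(5) by auto
      show "(r i - r a) * poly P (r i) = 0"
        using that Suc.prems(4)[of i] by (simp add: Q algebra_simps)
    qed
    ultimately have "card (W - {a}) \<le> k"
      using P Suc.prems by (intro Suc.IH[of P]) auto
    then show ?thesis using a Suc.prems(3) by (simp add: card_Diff_singleton)
  qed simp
qed

lemma theta_notin_span_lower:
  assumes "k < card (UNIV :: 'v::finite set)"
  shows "(theta k :: ('v, 'k::field) mpoly \<Rightarrow> _) \<notin> der.span (theta ` {..<k})"
proof
  \<comment> \<open>Each element of the span acts on all variables by one univariate polynomial,
    without coefficients from \<open>k\<close> on.\<close>
  have ex: "\<exists>P. (\<forall>i. \<eta> (Var i) = poly P (Var i)) \<and> (\<forall>n\<ge>k. coeff P n = 0)"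
    if "\<eta> \<in> der.span (theta ` {..<k})" for \<eta> :: "('v, 'k) mpoly \<Rightarrow> ('v, 'k) mpoly"
    using that
  proof (induction rule: der.span_induct_alt)
    case base
    show ?case by (intro exI[of _ 0]) simp
  next
    case (step c x y)
    then obtain n P where n: "x = theta n" "n < k" and P: "\<forall>i. y (Var i) = poly P (Var i)" "\<forall>n\<ge>k. coeff P n = 0"
      by auto
    show ?case
      using n P by (intro exI[of _ "P + smult c (monom 1 n)"]) (auto simp: der_scale_def poly_monom)
  qed
  assume "(theta k :: ('v, 'k) mpoly \<Rightarrow> _) \<in> der.span (theta ` {..<k})"
  then obtain P where P: "\<And>i. (Var i :: ('v, 'k) mpoly) ^ k = poly P (Var i)" "\<And>n. n \<ge> k \<Longrightarrow> coeff P n = 0"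
    using ex[of "theta k"] by auto
  have "card (UNIV :: 'v set) \<le> k"
  proof (rule card_roots_le[of "monom 1 k - P" k UNIV Var])
    show "poly (monom 1 k - P) (Var i) = 0" for i using P by (simp add: poly_monom)
    show "nzdiv (Var i - Var j :: ('v, 'k) mpoly)" if "i \<noteq> j" for i j using that by (rule nzdiv_Var_diff)
  qed (use P in auto)
  then show False using assms by simp
qed

section \<open>Connectivity and the size of separators\<close>

lemma k_connected_connectivity:
  assumes "finite V" "V \<noteq> {}"
  shows "k_connected V E (connectivity V E)" "\<not> k_connected V E (Suc (connectivity V E))"
proof -
  have bound: "\<forall>k. k_connected V E k \<longrightarrow> k \<le> card V" by (simp add: k_connected_def)
  have "k_connected V E 0" using assms by (simp add: k_connected_def card_gt_0_iff)
  then show "k_connected V E (connectivity V E)"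
    unfolding connectivity_def using bound by (intro GreatestI_nat[of "k_connected V E" 0 "card V"]) auto
  show "\<not> k_connected V E (Suc (connectivity V E))"
    using Greatest_le_nat[of "k_connected V E" "Suc (connectivity V E)" "card V"] bound
    by (auto simp: connectivity_def)
qed

text \<open>Hence no separator-based derivation has degree below the connectivity, on which the
  degree argument for minimality rests.\<close>

lemma separator_card_ge:
  assumes "k_connected V E k" "separator V E T"
  shows "k \<le> card T"
proof (rule ccontr)
  assume "\<not> k \<le> card T"
  then have "connected_graph (V - T) (E \<setminus>\<^sub>E T)"
    using assms by (auto simp: k_connected_def separator_def)
  then show False using assms(2) unfolding separator_iff connected_graph_def by blast
qed

lemma D_graphic_eq_span:
  fixes E :: "'v::finite set set"
  shows "der.span (theta ` {0..connectivity UNIV E} \<union> sep_ders E)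
    = (D_graphic E :: (('v, 'k::field) mpoly \<Rightarrow> ('v, 'k) mpoly) set)" (is "?S = ?D")
proof
  show "?S \<subseteq> ?D"
    by (intro der.span_minimal subspace_D_graphic)
      (auto simp: theta_in_D_graphic sep_ders_def theta_sep_in_D_graphic)
  let ?d = "connectivity UNIV E"
  have d: "k_connected UNIV E ?d" "\<not> k_connected UNIV E (Suc ?d)"
    by (simp_all add: k_connected_connectivity)
  have "(theta k :: ('v, 'k) mpoly \<Rightarrow> ('v, 'k) mpoly) \<in> ?S" if k: "k < card (UNIV :: 'v set)" for k
  proof (cases "k \<le> ?d")
    case True
    then show ?thesis by (intro der.span_base) auto
  next
    case False
    \<comment> \<open>There are enough vertices, so connectedness of order \<open>Suc ?d\<close> can
      fail only through a disconnecting set \<open>X\<close> of at most \<open>?d\<close>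
      vertices.\<close>
    then have "Suc ?d < card (UNIV :: 'v set)" using k by simp
    then obtain X where X: "card X < Suc ?d" "\<not> connected_graph (UNIV - X) (E \<setminus>\<^sub>E X)"
      using d(2) by (auto simp: k_connected_def)
    have "X \<noteq> UNIV" using X(1) \<open>Suc ?d < _\<close> by auto
    then obtain a b where "a \<notin> X" "b \<notin> X" "\<not> reaches (UNIV - X) (E \<setminus>\<^sub>E X) a b"
      using X(2) unfolding connected_graph_def by blast
    then show ?thesis using X(1) k by (intro theta_in_span_sep) auto
  qed
  then have "der.span (theta ` {..<card (UNIV :: 'v set)} \<union> sep_ders E) \<subseteq> ?S"
    by (intro der.span_minimal) (auto intro: der.span_base)
  then show "?D \<subseteq> ?S" using D_graphic_subset_span by blast
qed

text \<open>In degree \<open>k\<close>, at most the degree of any member of \<open>F\<close>, the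
  scalars in front of \<open>F\<close> contribute only constants.\<close>

lemma theta_notin_span_others:
  fixes F :: "(('v::finite, 'k::field) mpoly \<Rightarrow> ('v, 'k) mpoly) set"
  assumes k: "k \<le> d" "d < card (UNIV :: 'v set)"
    and F: "F \<subseteq> {theta_sep T C | T C. d \<le> card T}"
    and irredundant: "\<And>\<eta>. \<eta> \<in> F \<Longrightarrow> \<eta> \<notin> der.span (theta ` {0..d} \<union> (F - {\<eta>}))"
  shows "theta k \<notin> der.span (theta ` {0..d} \<union> F - {theta k})"
proof
  let ?\<Theta> = "theta ` {0..d} :: (('v, 'k) mpoly \<Rightarrow> ('v, 'k) mpoly) set"
  let ?B = "?\<Theta> \<union> F - {theta k}"
  have "F \<subseteq> (\<lambda>(T, C). theta_sep T C) ` UNIV" using F by auto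
  then have "finite F" by (rule finite_subset) simp
  then have finB: "finite ?B" by simp
  have Der: "\<eta> \<in> Der" if "\<eta> \<in> ?B" for \<eta>
    using that F theta_in_Der theta_sep_in_Der by auto
  assume "theta k \<in> der.span ?B"
  then obtain u where u: "theta k = (\<Sum>\<eta>\<in>?B. der_scale (u \<eta>) \<eta>)"
    unfolding der.span_finite[OF finB] by auto
  \<comment> \<open>The scalar \<open>w\<close> is the homogeneous part of \<open>u \<eta>\<close>
    of complementary degree, and zero if \<eta> has degree above \<open>k\<close>.\<close>
  have "\<exists>w. (\<forall>i. hcomp k (u \<eta> * \<eta> (Var i)) = w * \<eta> (Var i)) \<and>
          (w = 0 \<or> \<eta> \<in> theta ` {..<k} \<or> \<eta> \<in> F \<and> (\<exists>c. c \<noteq> 0 \<and> w = Const c))"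
    if \<eta>: "\<eta> \<in> ?B" for \<eta>
  proof (cases "\<eta> \<in> ?\<Theta>")
    case True
    then obtain j where j: "\<eta> = theta j" "j \<noteq> k" using \<eta> by auto
    have "hcomp k (u \<eta> * \<eta> (Var i)) = (if j \<le> k then hcomp (k - j) (u \<eta>) else 0) * \<eta> (Var i)" for i
      using hcomp_mult_homogeneous[OF homogeneous_Var_power[of j i], of k "u \<eta>"] by (simp add: j)
    then show ?thesis using j by (intro exI[of _ "if j \<le> k then hcomp (k - j) (u \<eta>) else 0"]) auto
  next
    case False
    then have "\<eta> \<in> F" using \<eta> by auto
    then obtain T C where T: "\<eta> = theta_sep T C" "d \<le> card T" using F by auto
    have hom: "homogeneous (card T) (\<eta> (Var i))" for i
      by (simp add: T homogeneous_prod_linear homogeneous_0)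
    let ?w = "if card T = k then hcomp 0 (u \<eta>) else 0"
    have "hcomp k (u \<eta> * \<eta> (Var i)) = ?w * \<eta> (Var i)" for i
      using hcomp_mult_homogeneous[OF hom, of k "u \<eta>"] T(2) k by auto
    moreover have "?w = 0 \<or> (\<exists>c. c \<noteq> 0 \<and> ?w = Const c)"
      by (cases "Poly_Mapping.lookup (u \<eta>) 0 = 0") (auto simp: hcomp_0_eq_Const Const_def)
    ultimately show ?thesis using \<open>\<eta> \<in> F\<close> by blast
  qed
  then obtain w where w: "\<And>\<eta> i. \<eta> \<in> ?B \<Longrightarrow> hcomp k (u \<eta> * \<eta> (Var i)) = w \<eta> * \<eta> (Var i)"
    and cases: "\<And>\<eta>. \<eta> \<in> ?B \<Longrightarrow> w \<eta> = 0 \<or> \<eta> \<in> theta ` {..<k} \<or> \<eta> \<in> F \<and> (\<exists>c. c \<noteq> 0 \<and> w \<eta> = Const c)"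
    by metis
  have eq: "theta k = (\<Sum>\<eta>\<in>?B. der_scale (w \<eta>) \<eta>)"
  proof (rule Der_eqI[OF theta_in_Der])
    show "(\<Sum>\<eta>\<in>?B. der_scale (w \<eta>) \<eta>) \<in> Der"
      using Der by (intro der.subspace_sum der.subspace_scale subspace_Der)
    fix i :: 'v
    have "theta k (Var i) = hcomp k (theta k (Var i) :: ('v, 'k) mpoly)"
      by (simp add: hcomp_homogeneous[OF homogeneous_Var_power])
    also have "\<dots> = hcomp k (\<Sum>\<eta>\<in>?B. u \<eta> * \<eta> (Var i))"
      by (subst u) (simp add: sum_fun_apply der_scale_def)
    also have "\<dots> = (\<Sum>\<eta>\<in>?B. w \<eta> * \<eta> (Var i))"
      unfolding hcomp_sum by (intro sum.cong refl w)
    also have "\<dots> = (\<Sum>\<eta>\<in>?B. der_scale (w \<eta>) \<eta>) (Var i)"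
      by (simp add: sum_fun_apply der_scale_def)
    finally show "theta k (Var i) = (\<Sum>\<eta>\<in>?B. der_scale (w \<eta>) \<eta>) (Var i)" .
  qed
  show False
  proof (cases "\<exists>\<eta>\<in>?B. \<eta> \<in> F \<and> (\<exists>c. c \<noteq> 0 \<and> w \<eta> = Const c)")
    case True
    \<comment> \<open>The nonzero constant is invertible, so the relation can be solved for \<eta>,
      against irredundancy.\<close>
    then obtain \<eta> c where \<eta>: "\<eta> \<in> ?B" "\<eta> \<in> F" and c: "c \<noteq> 0" "w \<eta> = Const c" by blast
    let ?S = "der.span (?\<Theta> \<union> (F - {\<eta>}))"
    have "theta k \<in> ?S" using k by (intro der.span_base) auto
    moreover have "(\<Sum>\<zeta>\<in>?B - {\<eta>}. der_scale (w \<zeta>) \<zeta>) \<in> ?S"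
      by (intro der.span_sum der.span_scale der.span_base) auto
    ultimately have mem: "theta k - (\<Sum>\<zeta>\<in>?B - {\<eta>}. der_scale (w \<zeta>) \<zeta>) \<in> ?S"
      by (rule der.span_diff)
    have "theta k = der_scale (Const c) \<eta> + (\<Sum>\<zeta>\<in>?B - {\<eta>}. der_scale (w \<zeta>) \<zeta>)"
      using trans[OF eq sum.remove[OF finB \<eta>(1)]] by (simp only: c(2))
    then have eq': "theta k - (\<Sum>\<zeta>\<in>?B - {\<eta>}. der_scale (w \<zeta>) \<zeta>) = der_scale (Const c) \<eta>"
      by (simp only: diff_eq_eq)
    have "der_scale (Const (inverse c)) (der_scale (Const c) \<eta>) \<in> ?S"
      using mem unfolding eq' by (rule der.span_scale)
    moreover have "der_scale (Const (inverse c)) (der_scale (Const c) \<eta>) = \<eta>"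
      using c(1) by (simp add: Const_def mult_single)
    ultimately show False using irredundant[OF \<eta>(2)] by simp
  next
    case False
    have "der_scale (w \<eta>) \<eta> \<in> der.span (theta ` {..<k})" if "\<eta> \<in> ?B" for \<eta>
    proof (cases "w \<eta> = 0")
      case True
      then show ?thesis by (metis der.scale_zero_left der.span_zero)
    next
      case nz: False
      then have "\<eta> \<in> theta ` {..<k}" using cases[OF that] False that by blast
      then show ?thesis by (intro der.span_scale der.span_base)
    qed
    then have "(\<Sum>\<eta>\<in>?B. der_scale (w \<eta>) \<eta>) \<in> der.span (theta ` {..<k})"
      by (rule der.span_sum)
    then have "theta k \<in> der.span (theta ` {..<k} :: (('v, 'k) mpoly \<Rightarrow> ('v, 'k) mpoly) set)"
      unfolding eq[symmetric] .
    then show False using theta_notin_span_lower k by (meson le_less_trans)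
  qed
qed

theorem theorem1p3:
  fixes E :: "'v::finite set set"
  assumes "simple_graph UNIV E"
    and "connected_graph UNIV E"
  shows "\<exists>F :: (('v, 'k::field) mpoly \<Rightarrow> ('v, 'k) mpoly) set.
           finite F \<and>
           F \<subseteq> {theta_sep T C | T C. separator UNIV E T \<and> C \<in> components (UNIV - T) (E \<setminus>\<^sub>E T)} \<and>
           minimal_generating_set (D_graphic E) (theta ` {0..connectivity UNIV E} \<union> F)"
proof -
  let ?d = "connectivity UNIV E"
  let ?\<Theta> = "theta ` {0..?d} :: (('v, 'k) mpoly \<Rightarrow> ('v, 'k) mpoly) set"
  let ?D = "D_graphic E :: (('v, 'k) mpoly \<Rightarrow> ('v, 'k) mpoly) set"
  define gen where "gen F \<longleftrightarrow> F \<subseteq> sep_ders E \<and> der.span (?\<Theta> \<union> F) = ?D" for F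
  have "gen (sep_ders E)" by (simp add: gen_def D_graphic_eq_span)
  \<comment> \<open>Least cardinality makes each member of \<open>F\<close> indispensable alongside
    the \<open>theta k\<close>.\<close>
  then obtain F where F: "gen F" and least: "\<And>G. gen G \<Longrightarrow> card F \<le> card G"
    using ex_has_least_nat[of gen "sep_ders E" card] by blast
  have F_sub: "F \<subseteq> sep_ders E" and F_span: "der.span (?\<Theta> \<union> F) = ?D" using F by (auto simp: gen_def)
  have fin: "finite F" using F_sub finite_sep_ders by (rule finite_subset)
  have drop: "der.span (?\<Theta> \<union> (F - {\<eta>})) \<noteq> ?D" if "\<eta> \<in> F" for \<eta>
  proof
    assume "der.span (?\<Theta> \<union> (F - {\<eta>})) = ?D"
    then have "gen (F - {\<eta>})" using F_sub by (auto simp: gen_def)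
    then show False using least[of "F - {\<eta>}"] card_Diff1_less[OF fin that] by simp
  qed
  have conn: "k_connected UNIV E ?d" by (simp add: k_connected_connectivity)
  have theta_irredundant: "theta k \<notin> der.span (?\<Theta> \<union> F - {theta k})" if "k \<le> ?d" for k
  proof (rule theta_notin_span_others[OF that])
    show "?d < card (UNIV :: 'v set)" using conn by (simp add: k_connected_def)
    show "F \<subseteq> {theta_sep T C | T C. ?d \<le> card T}"
      using F_sub separator_card_ge[OF conn] unfolding sep_ders_def by blast
    show "\<eta> \<notin> der.span (?\<Theta> \<union> (F - {\<eta>}))" if "\<eta> \<in> F" for \<eta>
    proof
      assume "\<eta> \<in> der.span (?\<Theta> \<union> (F - {\<eta>}))"
      then have "?\<Theta> \<union> F \<subseteq> der.span (?\<Theta> \<union> (F - {\<eta>}))" using der.span_superset[of "?\<Theta> \<union> (F - {\<eta>})"] by blast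
      then have "?D \<subseteq> der.span (?\<Theta> \<union> (F - {\<eta>}))" unfolding F_span[symmetric] by (rule der.span_minimal) simp
      moreover have "der.span (?\<Theta> \<union> (F - {\<eta>})) \<subseteq> ?D" unfolding F_span[symmetric] by (rule der.span_mono) auto
      ultimately show False using drop[OF that] by blast
    qed
  qed
  have "der.span B \<noteq> ?D" if B: "B \<subset> ?\<Theta> \<union> F" for B
  proof
    assume D: "der.span B = ?D"
    \<comment> \<open>A proper subset omits some generator, so it suffices to rule out the removal
      of a single one.\<close>
    obtain \<eta> where \<eta>: "\<eta> \<in> ?\<Theta> \<union> F" "\<eta> \<notin> B" using B by blast
    then have sub: "?D \<subseteq> der.span (?\<Theta> \<union> F - {\<eta>})"
      unfolding D[symmetric] using B by (intro der.span_mono) auto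
    show False
    proof (cases "\<eta> \<in> ?\<Theta>")
      case True
      then obtain k where "k \<le> ?d" "\<eta> = theta k" by auto
      then show False using theta_irredundant sub theta_in_D_graphic by blast
    next
      case False
      then have "?\<Theta> \<union> F - {\<eta>} = ?\<Theta> \<union> (F - {\<eta>})" "\<eta> \<in> F" using \<eta> by auto
      moreover have "der.span (?\<Theta> \<union> (F - {\<eta>})) \<subseteq> ?D" unfolding F_span[symmetric] by (rule der.span_mono) auto
      ultimately show False using drop sub by auto
    qed
  qed
  then have "minimal_generating_set ?D (?\<Theta> \<union> F)"
    unfolding minimal_generating_set_def using F_span by blast
  then show ?thesis using fin F_sub unfolding sep_ders_def by blast
qed

end
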